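(* Let $\mathcal C$ be the class of nonempty, bounded, open, convex subsets of $\mathbb R^3$, and let $J_{\mathrm{Per}}(\Omega):=\mathrm{Per}(\Omega)\,\lambda_1^{\mathrm{Max}}(\Omega)$. Let $\{\Omega_k\}_{k\in\mathbb N}\subset\mathcal C$ be a minimising sequence for $\inf_{\Omega\in\mathcal C}J_{\mathrm{Per}}(\Omega)$, that is, $J_{\mathrm{Per}}(\Omega_k)\to\inf_{\mathcal C}J_{\mathrm{Per}}$. Then there exist points $a_k\in\Omega_k$ such that, after setting $$\widetilde\Omega_k:=\frac{\Omega_k-a_k}{\operatorname{diam}(\Omega_k)},$$ one may extract a subsequence satisfying $\overline{\widetilde\Omega_k}\to K$ in the Hausdorff sense for some compact convex set $K\subset\mathbb R^3$ with $\operatorname{diam}(K)=1$. Moreover, exactly one of the following occurs: (i) $\dim K=3$; (ii) $\dim K=2$, in which case $K$ is a compact planar convex set with nonempty relative interior; (iii) $\dim K=1$, in which case $K$ is a segment.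
   Context: $\mathrm{Per}(\Omega)$ is the De Giorgi perimeter of $\Omega$. The dimension $\dim K$ of a convex set $K$ is the dimension of its affine hull. Hausdorff convergence means convergence for the Hausdorff distance between compact sets. First Maxwell eigenvalue. For $\Omega\subset\mathbb R^3$ nonempty, bounded, open and convex, let $\mathbf H(\operatorname{curl};\Omega)$ be the space of $\mathbf u\in L^2(\Omega)^3$ with distributional $\operatorname{curl}\mathbf u\in L^2(\Omega)^3$, and let $\mathbf H_0(\operatorname{curl};\Omega)$ be the closure of $C_c^\infty(\Omega)^3$ in $\mathbf H(\operatorname{curl};\Omega)$ (equivalently, the fields with zero tangential trace $\mathbf u\times\mathbf n=0$ on $\partial\Omega$). Set $\mathcal S(\Omega):=\{\mathbf E\in\mathbf H_0(\operatorname{curl};\Omega):\operatorname{div}\mathbf E=0\text{ in }\Omega\}$ and $$\lambda_1^{\mathrm{Max}}(\Omega):=\min_{\mathbf E\in\mathcal S(\Omega)\setminus\{0\}}\frac{\int_\Omega|\operatorname{curl}\mathbf E|^2\,dx}{\int_\Omega|\mathbf E|^2\,dx}.$$ *)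

theory Defs
  imports "HOL-Analysis.Analysis"
begin

section \<open>Smooth compactly supported functions\<close>

definition partial_deriv :: "'n::finite \<Rightarrow> (real^'n \<Rightarrow> 'b::real_normed_vector) \<Rightarrow> real^'n \<Rightarrow> 'b"
  where "partial_deriv i f x = frechet_derivative f (at x) (axis i 1)"

primrec C_diff :: "nat \<Rightarrow> (real^'n::finite \<Rightarrow> 'b::real_normed_vector) \<Rightarrow> bool" where
  "C_diff 0 f \<longleftrightarrow> continuous_on UNIV f"
| "C_diff (Suc k) f \<longleftrightarrow> (\<forall>x. f differentiable (at x)) \<and> (\<forall>i. C_diff k (partial_deriv i f))"

definition compact_support_in :: "('a::topological_space) set \<Rightarrow> ('a \<Rightarrow> 'b::zero) \<Rightarrow> bool"
  where "compact_support_in U f \<longleftrightarrow>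
    compact (closure {x. f x \<noteq> 0}) \<and> closure {x. f x \<noteq> 0} \<subseteq> U"

text \<open>Elements of \<open>C\<^sub>c\<^sup>\<infinity>(U)\<close> are represented by their extension by zero to the whole space.\<close>

definition test_functions :: "(real^'n::finite) set \<Rightarrow> (real^'n \<Rightarrow> 'b::real_normed_vector) set"
  where "test_functions U = {\<phi>. (\<forall>k. C_diff k \<phi>) \<and> compact_support_in U \<phi>}"

definition grad :: "(real^'n::finite \<Rightarrow> real) \<Rightarrow> real^'n \<Rightarrow> real^'n"
  where "grad f x = (\<chi> i. partial_deriv i f x)"

definition div_field :: "(real^'n::finite \<Rightarrow> real^'n) \<Rightarrow> real^'n \<Rightarrow> real"
  where "div_field F x = (\<Sum>i\<in>UNIV. partial_deriv i F x $ i)"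

definition curl :: "(real^3 \<Rightarrow> real^3) \<Rightarrow> real^3 \<Rightarrow> real^3"
  where "curl F x = vector
    [partial_deriv 2 F x $ 3 - partial_deriv 3 F x $ 2,
     partial_deriv 3 F x $ 1 - partial_deriv 1 F x $ 3,
     partial_deriv 1 F x $ 2 - partial_deriv 2 F x $ 1]"

section \<open>De Giorgi perimeter\<close>

definition perimeter :: "(real^'n::finite) set \<Rightarrow> ereal"
  where "perimeter U =
    (SUP T \<in> {T :: real^'n \<Rightarrow> real^'n.
        C_diff 1 T \<and> compact_support_in UNIV T \<and> (\<forall>x. norm (T x) \<le> 1)}.
      ereal (integral\<^sup>L (lebesgue_on U) (div_field T)))"

section \<open>The first Maxwell eigenvalue\<close>

text \<open>Fields are honest functions; two of them represent the same element of \<open>L\<^sup>2(U)\<^sup>3\<close>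
  iff they agree almost everywhere on \<open>U\<close>. Values outside \<open>U\<close> are irrelevant.\<close>

definition L2_fields :: "(real^3) set \<Rightarrow> (real^3 \<Rightarrow> real^3) set"
  where "L2_fields U = {u. u \<in> borel_measurable (lebesgue_on U) \<and>
    integrable (lebesgue_on U) (\<lambda>x. (norm (u x))\<^sup>2)}"

definition L2_norm_sq :: "(real^3) set \<Rightarrow> (real^3 \<Rightarrow> real^3) \<Rightarrow> real"
  where "L2_norm_sq U u = integral\<^sup>L (lebesgue_on U) (\<lambda>x. (norm (u x))\<^sup>2)"

definition is_weak_curl :: "(real^3) set \<Rightarrow> (real^3 \<Rightarrow> real^3) \<Rightarrow> (real^3 \<Rightarrow> real^3) \<Rightarrow> bool"
  where "is_weak_curl U u w \<longleftrightarrow> w \<in> L2_fields U \<and>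
    (\<forall>\<phi> \<in> test_functions U.
      integral\<^sup>L (lebesgue_on U) (\<lambda>x. w x \<bullet> \<phi> x) =
      integral\<^sup>L (lebesgue_on U) (\<lambda>x. u x \<bullet> curl \<phi> x))"

definition H_curl :: "(real^3) set \<Rightarrow> (real^3 \<Rightarrow> real^3) set"
  where "H_curl U = {u \<in> L2_fields U. \<exists>w. is_weak_curl U u w}"

text \<open>For \<open>u\<close> in \<open>H_curl U\<close>, \<open>U\<close> open, the weak curl is unique up to null sets, so the
  choice made here does not affect any integral over \<open>U\<close>.\<close>

definition weak_curl :: "(real^3) set \<Rightarrow> (real^3 \<Rightarrow> real^3) \<Rightarrow> real^3 \<Rightarrow> real^3"
  where "weak_curl U u = (SOME w. is_weak_curl U u w)"

definition H_curl_norm :: "(real^3) set \<Rightarrow> (real^3 \<Rightarrow> real^3) \<Rightarrow> real"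
  where "H_curl_norm U u = sqrt (L2_norm_sq U u + L2_norm_sq U (weak_curl U u))"

text \<open>The closure of the test fields with respect to the graph norm.\<close>

definition H0_curl :: "(real^3) set \<Rightarrow> (real^3 \<Rightarrow> real^3) set"
  where "H0_curl U = {u \<in> H_curl U.
    \<forall>\<epsilon>>0. \<exists>\<phi> \<in> test_functions U. H_curl_norm U (\<lambda>x. u x - \<phi> x) < \<epsilon>}"

definition weakly_div_free :: "(real^3) set \<Rightarrow> (real^3 \<Rightarrow> real^3) \<Rightarrow> bool"
  where "weakly_div_free U u \<longleftrightarrow>
    (\<forall>\<phi> \<in> test_functions U. integral\<^sup>L (lebesgue_on U) (\<lambda>x. u x \<bullet> grad \<phi> x) = 0)"

definition maxwell_space :: "(real^3) set \<Rightarrow> (real^3 \<Rightarrow> real^3) set"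
  where "maxwell_space U = {E \<in> H0_curl U. weakly_div_free U E}"

text \<open>On bounded convex domains the infimum is attained, hence is the minimum of the
  Rayleigh quotient. The side condition says that \<open>E\<close> is nonzero as an element of \<open>L\<^sup>2\<close>.\<close>

definition maxwell_eigenvalue1 :: "(real^3) set \<Rightarrow> ereal"
  where "maxwell_eigenvalue1 U =
    (INF E \<in> {E \<in> maxwell_space U. \<not> (AE x in lebesgue_on U. E x = 0)}.
      ereal (L2_norm_sq U (weak_curl U E) / L2_norm_sq U E))"

section \<open>The shape functional and Hausdorff convergence\<close>

definition convex_domains :: "(real^3) set set"
  where "convex_domains = {U. U \<noteq> {} \<and> bounded U \<and> open U \<and> convex U}"

definition J_Per :: "(real^3) set \<Rightarrow> ereal"
  where "J_Per U = perimeter U * maxwell_eigenvalue1 U"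

text \<open>Only meaningful for nonempty bounded sets, where both suprema are over nonempty,
  bounded-above families of reals.\<close>

definition hausdorff_dist :: "('a::metric_space) set \<Rightarrow> 'a set \<Rightarrow> real"
  where "hausdorff_dist A B = max (SUP x\<in>A. infdist x B) (SUP y\<in>B. infdist y A)"

definition hausdorff_converges :: "(nat \<Rightarrow> ('a::metric_space) set) \<Rightarrow> 'a set \<Rightarrow> bool"
  where "hausdorff_converges A B \<longleftrightarrow>
    (\<forall>j. A j \<noteq> {} \<and> compact (A j)) \<and> B \<noteq> {} \<and> compact B \<and>
    (\<lambda>j. hausdorff_dist (A j) B) \<longlonglongrightarrow> 0"

definition rescaled :: "'a::real_normed_vector set \<Rightarrow> 'a \<Rightarrow> 'a set"
  where "rescaled U a = (\<lambda>x. (x - a) /\<^sub>R diameter U) ` U"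

end

theory Submission
  imports Defs "HOL-Complex_Analysis.Great_Picard"
begin

text \<open>For any choice of points \<open>a\<^sub>k \<in> \<Omega>\<^sub>k\<close>, the closures
  of the rescaled sets all have diameter \<open>1\<close> and contain the origin, so they lie in the closed unit
  ball and Blaschke selection applies. The latter is Arzela-Ascoli for the \<open>1\<close>-Lipschitz distance
  functions: the zero set of their uniform limit is the Hausdorff limit. Convexity and diameter
  pass to the limit, and diameter \<open>1\<close> rules out a limit of dimension \<open>0\<close>.\<close>

section \<open>Metric estimates for the Hausdorff distance of compact sets\<close>

lemma hausdorff_dist_commute: "hausdorff_dist A B = hausdorff_dist B A"
  by (simp add: hausdorff_dist_def max.commute)

lemma hausdorff_dist_le:
  assumes "A \<noteq> {}" "B \<noteq> {}"
    and "\<And>x. x \<in> A \<Longrightarrow> infdist x B \<le> e" "\<And>y. y \<in> B \<Longrightarrow> infdist y A \<le> e"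
  shows "hausdorff_dist A B \<le> e"
  unfolding hausdorff_dist_def using assms by (intro max.boundedI cSUP_least) auto

text \<open>Compactness of \<open>A\<close> bounds the continuous function
  \<open>infdist _ B\<close> on \<open>A\<close>; a real supremum dominates its members only when
  the family is bounded above.\<close>

lemma infdist_le_hausdorff_dist:
  assumes "compact A" "x \<in> A"
  shows "infdist x B \<le> hausdorff_dist A B"
proof -
  have "compact ((\<lambda>x. infdist x B) ` A)"
    by (intro compact_continuous_image continuous_intros assms)
  then have "bdd_above ((\<lambda>x. infdist x B) ` A)"
    by (intro bounded_imp_bdd_above compact_imp_bounded)
  with \<open>x \<in> A\<close> have "infdist x B \<le> (SUP x\<in>A. infdist x B)"
    by (rule cSUP_upper)
  then show ?thesis
    by (simp add: hausdorff_dist_def le_max_iff_disj)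
qed

lemma hausdorff_dist_nonneg:
  assumes "compact A" "A \<noteq> {}"
  shows "0 \<le> hausdorff_dist A B"
  using assms infdist_le_hausdorff_dist infdist_nonneg by (metis all_not_in_conv order_trans)

text \<open>The distance from \<open>x\<close> to the closed set \<open>B\<close> is attained, so
  points can be moved from one set to the other without an extra epsilon.\<close>

lemma hausdorff_dist_obtain_near:
  fixes A B :: "'a::heine_borel set"
  assumes "compact A" "x \<in> A" "compact B" "B \<noteq> {}"
  obtains y where "y \<in> B" "dist x y \<le> hausdorff_dist A B"
  using infdist_attains_inf[OF compact_imp_closed, OF assms(3,4), of x]
    infdist_le_hausdorff_dist[OF assms(1,2), of B] by metis

text \<open>Go from \<open>z\<close> to its nearest point in \<open>A\<close>, and from there to a
  nearby point of \<open>B\<close>. This trades distance to an approximating set for distance to the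
  limit.\<close>

lemma infdist_le_infdist_add_hausdorff_dist:
  fixes A B :: "'a::heine_borel set"
  assumes "compact A" "A \<noteq> {}" "compact B" "B \<noteq> {}"
  shows "infdist z B \<le> infdist z A + hausdorff_dist A B"
proof -
  obtain x where x: "x \<in> A" "infdist z A = dist z x"
    using infdist_attains_inf[OF compact_imp_closed] assms by metis
  obtain y where "y \<in> B" "dist x y \<le> hausdorff_dist A B"
    using hausdorff_dist_obtain_near[OF assms(1) x(1) assms(3,4)] .
  with x show ?thesis
    using infdist_le[of y B z] dist_triangle[of z y x] by linarith
qed

section \<open>Passing diameter and convexity to a Hausdorff limit\<close>

lemma diameter_le_add_hausdorff_dist:
  fixes A B :: "'a::{heine_borel,real_normed_vector} set"
  assumes "compact A" "A \<noteq> {}" "compact B" "B \<noteq> {}"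
  shows "diameter A \<le> diameter B + 2 * hausdorff_dist A B"
proof (rule diameter_le)
  fix x y assume "x \<in> A" "y \<in> A"
  \<comment> \<open>Both endpoints of a chord of \<open>A\<close> are moved into \<open>B\<close>,
    each at the cost of one Hausdorff distance; hence the factor 2.\<close>
  obtain x' where "x' \<in> B" "dist x x' \<le> hausdorff_dist A B"
    using hausdorff_dist_obtain_near[OF assms(1) \<open>x \<in> A\<close> assms(3,4)] .
  moreover obtain y' where "y' \<in> B" "dist y y' \<le> hausdorff_dist A B"
    using hausdorff_dist_obtain_near[OF assms(1) \<open>y \<in> A\<close> assms(3,4)] .
  moreover have "dist x' y' \<le> diameter B" if "x' \<in> B" "y' \<in> B" for x' y'
    using diameter_bounded_bound[OF compact_imp_bounded] assms(3) that by blast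
  moreover have "dist x y \<le> dist x x' + dist x' y' + dist y y'"
    by metric
  ultimately show "norm (x - y) \<le> diameter B + 2 * hausdorff_dist A B"
    by (smt (verit) dist_norm)
qed (use assms in auto)

lemma hausdorff_converges_diameter:
  fixes A :: "nat \<Rightarrow> 'a::{heine_borel,real_normed_vector} set"
  assumes "hausdorff_converges A K"
  shows "(\<lambda>j. diameter (A j)) \<longlonglongrightarrow> diameter K"
proof -
  have A: "\<And>j. A j \<noteq> {}" "\<And>j. compact (A j)" and K: "K \<noteq> {}" "compact K"
    and lim: "(\<lambda>j. hausdorff_dist (A j) K) \<longlonglongrightarrow> 0"
    using assms by (auto simp: hausdorff_converges_def)
  have "dist (diameter (A j)) (diameter K) \<le> 2 * hausdorff_dist (A j) K" for j
    using diameter_le_add_hausdorff_dist[OF A(2,1) K(2,1), of j]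
      diameter_le_add_hausdorff_dist[OF K(2,1) A(2,1), of j]
    by (simp add: dist_real_def abs_le_iff hausdorff_dist_commute[of K])
  then show ?thesis
    unfolding tendsto_dist_iff[of _ "diameter K"]
    by (intro tendsto_sandwich[OF _ _ tendsto_const tendsto_mult_right_zero[OF lim, of 2]]) simp_all
qed

text \<open>The same convex combination of the nearest points to \<open>x\<close> and
  \<open>y\<close> lies in \<open>A\<close> and serves as a competitor.\<close>

lemma infdist_convex_combination_le:
  fixes A :: "'a::{heine_borel,real_normed_vector} set"
  assumes "closed A" "A \<noteq> {}" "convex A" "0 \<le> u" "0 \<le> v" "u + v = 1"
  shows "infdist (u *\<^sub>R x + v *\<^sub>R y) A \<le> u * infdist x A + v * infdist y A"
proof -
  obtain p where p: "p \<in> A" "infdist x A = dist x p"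
    using infdist_attains_inf[OF assms(1,2)] .
  obtain q where q: "q \<in> A" "infdist y A = dist y q"
    using infdist_attains_inf[OF assms(1,2)] .
  have "u *\<^sub>R p + v *\<^sub>R q \<in> A"
    using convexD[OF \<open>convex A\<close> p(1) q(1) assms(4-6)] .
  then have "infdist (u *\<^sub>R x + v *\<^sub>R y) A \<le> dist (u *\<^sub>R x + v *\<^sub>R y) (u *\<^sub>R p + v *\<^sub>R q)"
    by (rule infdist_le)
  also have "\<dots> \<le> dist (u *\<^sub>R x) (u *\<^sub>R p) + dist (v *\<^sub>R y) (v *\<^sub>R q)"
    by (rule dist_triangle_add)
  also have "\<dots> = u * infdist x A + v * infdist y A"
    using assms(4,5) by (simp add: p q dist_norm flip: scaleR_diff_right)
  finally show ?thesis .
qed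

lemma hausdorff_converges_convex:
  fixes A :: "nat \<Rightarrow> 'a::{heine_borel,real_normed_vector} set"
  assumes "hausdorff_converges A K" "\<And>j. convex (A j)"
  shows "convex K"
proof (rule convexI)
  have A: "\<And>j. A j \<noteq> {}" "\<And>j. compact (A j)" and K: "K \<noteq> {}" "compact K"
    and lim: "(\<lambda>j. hausdorff_dist (A j) K) \<longlonglongrightarrow> 0"
    using assms(1) by (auto simp: hausdorff_converges_def)
  fix x y and u v :: real
  assume xy: "x \<in> K" "y \<in> K" and uv: "0 \<le> u" "0 \<le> v" "u + v = 1"
  let ?z = "u *\<^sub>R x + v *\<^sub>R y"
  \<comment> \<open>One Hausdorff distance bounds the distance from \<open>?z\<close> to
    \<open>A j\<close>, by convexity of \<open>A j\<close>; the second pays for replacing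
    \<open>A j\<close> by \<open>K\<close>.\<close>
  have "infdist ?z K \<le> 2 * hausdorff_dist (A j) K" for j
  proof -
    let ?h = "hausdorff_dist (A j) K"
    have near: "infdist w (A j) \<le> ?h" if "w \<in> K" for w
      using infdist_le_hausdorff_dist[OF K(2) that, of "A j"] by (simp add: hausdorff_dist_commute)
    have "infdist ?z (A j) \<le> u * infdist x (A j) + v * infdist y (A j)"
      by (intro infdist_convex_combination_le compact_imp_closed A assms uv)
    also have "\<dots> \<le> u * ?h + v * ?h"
      by (intro add_mono mult_left_mono near xy uv)
    also have "\<dots> = ?h"
      using uv(3) by (simp flip: distrib_right)
    finally show ?thesis
      using infdist_le_infdist_add_hausdorff_dist[OF A(2,1) K(2,1), of ?z j] by linarith
  qed
  moreover have "(\<lambda>j. 2 * hausdorff_dist (A j) K) \<longlonglongrightarrow> 0"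
    using tendsto_mult_right_zero[OF lim] .
  ultimately have "infdist ?z K \<le> 0"
    by (intro LIMSEQ_le_const[where a = "infdist ?z K" and x = 0] exI allI impI)
  then show "?z \<in> K"
    using in_closed_iff_infdist_zero[OF compact_imp_closed] K infdist_nonneg[of ?z K] by force
qed

section \<open>Compactness for the Hausdorff distance\<close>

theorem blaschke_selection:
  fixes A :: "nat \<Rightarrow> 'a::euclidean_space set"
  assumes "compact B" and A: "\<And>j. A j \<noteq> {}" "\<And>j. compact (A j)" "\<And>j. A j \<subseteq> B"
  obtains r K where "strict_mono (r :: nat \<Rightarrow> nat)" "hausdorff_converges (A \<circ> r) K"
proof -
  have "bounded B"
    using \<open>compact B\<close> by (rule compact_imp_bounded)
  have bound: "norm (infdist x (A j)) \<le> diameter B" if x: "x \<in> B" for x j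
  proof -
    obtain y where "y \<in> A j"
      using A(1) by blast
    then have "infdist x (A j) \<le> dist x y" "dist x y \<le> diameter B"
      using infdist_le diameter_bounded_bound[OF \<open>bounded B\<close> x] A(3) by blast+
    then show ?thesis
      using infdist_nonneg[of x "A j"] by simp
  qed
  \<comment> \<open>The choice \<open>d = e\<close> works for all \<open>j\<close>, as distance
    functions are 1-Lipschitz.\<close>
  have equicont: "\<exists>d>0. \<forall>j y. y \<in> B \<and> norm (x - y) < d \<longrightarrow>
      norm (infdist x (A j) - infdist y (A j)) < e" if "0 < e" for x e
    using that infdist_triangle_abs by (metis dist_norm order_le_less_trans real_norm_def)
  obtain g r where g: "continuous_on B g" and r: "strict_mono (r :: nat \<Rightarrow> nat)"
    and unif: "\<And>e. 0 < e \<Longrightarrow> \<exists>N. \<forall>j x. j \<ge> N \<and> x \<in> B \<longrightarrow> norm (infdist x (A (r j)) - g x) < e"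
    using Arzela_Ascoli[of B "\<lambda>j x. infdist x (A j)" "diameter B", OF \<open>compact B\<close> bound equicont]
    by metis
  have pointwise: "(\<lambda>j. infdist x (A (r j))) \<longlonglongrightarrow> g x" if "x \<in> B" for x
    unfolding LIMSEQ_iff using unif that by blast
  define K where "K = {x \<in> B. g x = 0}"
  have "closed K"
    unfolding K_def using continuous_closed_preimage_constant[OF g compact_imp_closed] \<open>compact B\<close>
    by blast
  then have "compact K"
    using \<open>bounded B\<close> bounded_subset[of B K] by (auto simp: K_def compact_eq_bounded_closed)
  \<comment> \<open>The limit \<open>g\<close> controls the distance to its own zero set: nearest
    points to \<open>x\<close> in \<open>A (r j)\<close> accumulate at some \<open>l\<close> with
    \<open>dist x l = g x\<close>, and \<open>l\<close> turns out to be a zero of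
    \<open>g\<close>.\<close>
  have nearest: "\<exists>y\<in>K. dist x y = g x" if "x \<in> B" for x
  proof -
    have "\<exists>y. y \<in> A (r j) \<and> infdist x (A (r j)) = dist x y" for j
      using infdist_attains_inf[OF compact_imp_closed] A(1,2) by metis
    then obtain y where y: "\<And>j. y j \<in> A (r j)" "\<And>j. infdist x (A (r j)) = dist x (y j)"
      by metis
    then have "\<forall>j. y j \<in> B"
      using A(3) by blast
    then obtain l s where l: "l \<in> B" and s: "strict_mono (s :: nat \<Rightarrow> nat)"
      and yl: "(\<lambda>j. y (s j)) \<longlonglongrightarrow> l"
      using \<open>compact B\<close> unfolding compact_def comp_def by metis
    have "(\<lambda>j. dist x (y (s j))) \<longlonglongrightarrow> g x"
      using LIMSEQ_subseq_LIMSEQ[OF pointwise[OF that] s] by (simp add: comp_def y(2))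
    moreover have "(\<lambda>j. dist x (y (s j))) \<longlonglongrightarrow> dist x l"
      by (intro tendsto_intros yl)
    ultimately have "dist x l = g x"
      by (rule LIMSEQ_unique[rotated])
    \<comment> \<open>The points \<open>y (s j)\<close> of the approximating sets converge to
      \<open>l\<close>, so the distance from \<open>l\<close> to those sets vanishes in the
      limit.\<close>
    moreover have "g l = 0"
    proof -
      have "infdist l (A (r (s j))) \<le> dist (y (s j)) l" for j
        using infdist_le[OF y(1), of l "s j"] by (simp add: dist_commute)
      then have "(\<lambda>j. infdist l (A (r (s j)))) \<longlonglongrightarrow> 0"
        by (intro tendsto_sandwich[OF _ _ tendsto_const tendsto_dist_iff[THEN iffD1, OF yl]])
          (simp_all add: infdist_nonneg)
      moreover have "(\<lambda>j. infdist l (A (r (s j)))) \<longlonglongrightarrow> g l"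
        using LIMSEQ_subseq_LIMSEQ[OF pointwise[OF l] s] by (simp add: comp_def)
      ultimately show ?thesis
        by (rule LIMSEQ_unique[rotated])
    qed
    ultimately show ?thesis
      using l by (auto simp: K_def)
  qed
  have "K \<noteq> {}"
    using nearest A(1,3) by (metis empty_iff equals0I subsetD)
  have "(\<lambda>j. hausdorff_dist (A (r j)) K) \<longlonglongrightarrow> 0"
  proof (rule LIMSEQ_I)
    fix e :: real assume "0 < e"
    then obtain N where N: "\<And>j x. j \<ge> N \<Longrightarrow> x \<in> B \<Longrightarrow> \<bar>infdist x (A (r j)) - g x\<bar> < e / 2"
      using unif[of "e / 2"] by auto
    \<comment> \<open>On \<open>A (r j)\<close> the function \<open>infdist _ (A (r j))\<close> is
      zero, so \<open>g\<close> is small there and \<open>nearest\<close> supplies a point of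
      \<open>K\<close>. On \<open>K\<close> it is \<open>g\<close> that is zero. Halving
      \<open>e\<close> leaves room for the strict inequality.\<close>
    have "hausdorff_dist (A (r j)) K \<le> e / 2" if "j \<ge> N" for j
    proof (rule hausdorff_dist_le)
      fix x assume x: "x \<in> A (r j)"
      then obtain y where "y \<in> K" "dist x y = g x"
        using nearest A(3) by blast
      then have "infdist x K \<le> g x"
        by (metis infdist_le)
      also have "g x \<le> e / 2"
        using N[OF that subsetD[OF A(3) x]] x by simp
      finally show "infdist x K \<le> e / 2" .
    next
      fix y assume "y \<in> K"
      then show "infdist y (A (r j)) \<le> e / 2"
        using N[OF that, of y] by (auto simp: K_def abs_less_iff)
    qed (use A(1) \<open>K \<noteq> {}\<close> in auto)
    moreover have "0 \<le> hausdorff_dist (A (r j)) K" for j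
      using A(1,2) by (rule hausdorff_dist_nonneg[rotated])
    ultimately show "\<exists>N. \<forall>j\<ge>N. norm (hausdorff_dist (A (r j)) K - 0) < e"
      using \<open>0 < e\<close> by (intro exI[of _ N]) (smt (verit) field_sum_of_halves real_norm_def)
  qed
  with A(1,2) \<open>compact K\<close> \<open>K \<noteq> {}\<close> have "hausdorff_converges (A \<circ> r) K"
    by (simp add: hausdorff_converges_def)
  with r show ?thesis
    using that by blast
qed

section \<open>Normalising the diameter\<close>

lemma diameter_open_pos:
  fixes U :: "'a::{perfect_space,metric_space} set"
  assumes "open U" "bounded U" "U \<noteq> {}"
  shows "0 < diameter U"
proof -
  \<comment> \<open>A nonempty open set in a perfect space is not a singleton.\<close>
  obtain x y where "x \<in> U" "y \<in> U" "x \<noteq> y"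
    using assms(1,3) not_open_singleton by (metis is_singletonI' is_singleton_def)
  then show ?thesis
    using diameter_bounded_bound[OF assms(2)] zero_less_dist_iff by (metis order_less_le_trans)
qed

lemma diameter_rescaled:
  fixes U :: "'a::real_normed_vector set"
  assumes "bounded U" "0 < diameter U"
  shows "diameter (rescaled U a) = 1"
proof -
  have dist: "dist ((x - a) /\<^sub>R diameter U) ((y - a) /\<^sub>R diameter U) = dist x y / diameter U" for x y
    using assms(2) by (simp add: divide_inverse_commute dist_norm flip: scaleR_diff_right)
  have "diameter (rescaled U a) \<le> 1"
  proof (rule diameter_le)
    fix x y assume "x \<in> rescaled U a" "y \<in> rescaled U a"
    then obtain x' y' where "x' \<in> U" "y' \<in> U" "dist x y = dist x' y' / diameter U"
      unfolding rescaled_def using dist by auto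
    then show "norm (x - y) \<le> 1"
      using diameter_bounded_bound[OF assms(1)] assms(2) by (simp add: dist_norm)
  qed simp
  moreover have "1 \<le> diameter (rescaled U a)"
  proof (rule ccontr)
    assume less: "\<not> ?thesis"
    have bdd: "bounded (rescaled U a)"
      unfolding rescaled_def using bounded_scaling[OF bounded_translation_minus[OF assms(1)]]
      by (simp add: image_image)
    \<comment> \<open>Scaling back by \<open>diameter U\<close> bounds every chord of
      \<open>U\<close>; a rescaled diameter below 1 would then make \<open>diameter U\<close>
      smaller than itself.\<close>
    have "diameter U \<le> diameter (rescaled U a) * diameter U"
    proof (rule diameter_le)
      fix x y assume "x \<in> U" "y \<in> U"
      then have "dist x y / diameter U \<le> diameter (rescaled U a)"
        unfolding dist[symmetric] by (intro diameter_bounded_bound[OF bdd]) (auto simp: rescaled_def)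
      then show "norm (x - y) \<le> diameter (rescaled U a) * diameter U"
        using assms(2) by (simp add: dist_norm field_simps)
    qed (use assms(2) in auto)
    with less assms(2) show False
      by simp
  qed
  ultimately show ?thesis
    by simp
qed

section \<open>Compactness of the rescaled domains and the dimension of the limit\<close>

theorem theorem1p3:
  fixes \<Omega> :: "nat \<Rightarrow> (real^3) set"
  assumes in_class: "\<forall>k. \<Omega> k \<in> convex_domains"
    and minimising: "(\<lambda>k. J_Per (\<Omega> k)) \<longlonglongrightarrow> (INF U \<in> convex_domains. J_Per U)"
  shows "\<exists>a. (\<forall>k. a k \<in> \<Omega> k) \<and>
    (\<exists>(r :: nat \<Rightarrow> nat) K. strict_mono r \<and>
      hausdorff_converges (\<lambda>j. closure (rescaled (\<Omega> (r j)) (a (r j)))) K \<and>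
      compact K \<and> convex K \<and> diameter K = 1 \<and>
      ((aff_dim K = 3 \<and> aff_dim K \<noteq> 2 \<and> aff_dim K \<noteq> 1) \<or>
       (aff_dim K \<noteq> 3 \<and> aff_dim K = 2 \<and> aff_dim K \<noteq> 1) \<or>
       (aff_dim K \<noteq> 3 \<and> aff_dim K \<noteq> 2 \<and> aff_dim K = 1)) \<and>
      (aff_dim K = 2 \<longrightarrow>
         (\<exists>P. affine P \<and> aff_dim P = 2 \<and> K \<subseteq> P) \<and> rel_interior K \<noteq> {}) \<and>
      (aff_dim K = 1 \<longrightarrow> (\<exists>p q. p \<noteq> q \<and> K = closed_segment p q)))"
proof -
  have U: "\<Omega> k \<noteq> {}" "bounded (\<Omega> k)" "open (\<Omega> k)" "convex (\<Omega> k)" for k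
    using in_class by (auto simp: convex_domains_def)
  then have "\<exists>a. \<forall>k. a k \<in> \<Omega> k"
    by (intro choice) blast
  then obtain a where a: "\<And>k. a k \<in> \<Omega> k"
    by blast
  define A where "A k = closure (rescaled (\<Omega> k) (a k))" for k
  have bdd: "bounded (rescaled (\<Omega> k) (a k))" for k
    unfolding rescaled_def using bounded_scaling[OF bounded_translation_minus[OF U(2)]]
    by (simp add: image_image)
  have compact: "compact (A k)" and bounded: "bounded (A k)" for k
    unfolding A_def using bdd by (auto simp: compact_closure)
  have diam: "diameter (A k) = 1" for k
    unfolding A_def
    using diameter_closure[OF bdd] diameter_rescaled[OF U(2) diameter_open_pos[OF U(3,2,1)]] by simp
  have convex: "convex (A k)" for k
    unfolding A_def rescaled_def
    using convex_closure[OF convex_scaling[OF convex_translation_subtract[OF U(4)]]]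
    by (simp add: image_image)
  \<comment> \<open>The rescaling sends \<open>a k\<close> to the origin. With diameter 1 this
    confines every \<open>A k\<close> to the closed unit ball.\<close>
  have zero: "0 \<in> A k" for k
    unfolding A_def rescaled_def using a by (intro subsetD[OF closure_subset]) force
  have "A k \<subseteq> cball 0 1" for k
    using diameter_bounded_bound[OF bounded zero] by (auto simp: diam)
  then obtain r K where r: "strict_mono r" and conv: "hausdorff_converges (A \<circ> r) K"
    using blaschke_selection[OF compact_cball, of A] compact zero by (metis empty_iff)
  have K: "compact K" "K \<noteq> {}"
    using conv by (auto simp: hausdorff_converges_def)
  have "convex K"
    using hausdorff_converges_convex[OF conv] convex by simp
  have "diameter K = 1"
    using LIMSEQ_unique[OF hausdorff_converges_diameter[OF conv]] by (simp add: diam)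
  \<comment> \<open>A set of dimension 0 is a single point, whose diameter is 0.\<close>
  have "aff_dim K \<noteq> 0"
    using \<open>diameter K = 1\<close> by (auto simp: aff_dim_eq_0)
  \<comment> \<open>Only the empty set has negative dimension, namely -1.\<close>
  moreover have "0 \<le> aff_dim K"
    using K(2) aff_dim_negative_iff[of K] by linarith
  moreover have "aff_dim K \<le> 3"
    using aff_dim_le_DIM[of K] by simp
  ultimately have dim: "aff_dim K = 1 \<or> aff_dim K = 2 \<or> aff_dim K = 3"
    by linarith
  have planar: "\<exists>P. affine P \<and> aff_dim P = 2 \<and> K \<subseteq> P" if "aff_dim K = 2"
    using that by (intro exI[of _ "affine hull K"]) (simp add: hull_subset)
  have interior: "rel_interior K \<noteq> {}"
    using \<open>convex K\<close> K(2) by (simp add: rel_interior_eq_empty)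
  \<comment> \<open>Dimension 1 means that \<open>K\<close> is collinear, and a compact convex
    collinear set is a segment; equal endpoints would give dimension 0.\<close>
  have segment: "\<exists>p q. p \<noteq> q \<and> K = closed_segment p q" if dim1: "aff_dim K = 1"
  proof -
    obtain p q where pq: "K = closed_segment p q"
      using compact_convex_collinear_segment[OF K(2,1) \<open>convex K\<close>] dim1
      by (metis collinear_aff_dim order_refl)
    with dim1 have "p \<noteq> q"
      by auto
    with pq show ?thesis
      by blast
  qed
  show ?thesis
    using conv
    by (intro exI[of _ a] exI[of _ r] exI[of _ K] conjI allI impI a r K \<open>convex K\<close>
        \<open>diameter K = 1\<close> planar interior segment) (use dim in \<open>auto simp: A_def comp_def\<close>)
qed

end
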